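(* Let $\gamma:\mathbb R\to\mathbb R$ be $1$-periodic and $C^2$, let $d<0$, and let $\tilde c$ be a positive function, $C^2$-smooth in a neighborhood of $0$. Assume $$\tilde c(0)>0,\qquad \sqrt{\frac{-d}{2}}\,\left|\int_0^1\gamma(t)\,dt\right|<\tilde c(0).$$ Then for every sufficiently small $\varepsilon>0$ there are exactly four $1$-periodic solutions $(\psi,z)$ of the system $$\ddot\psi=4\left(\varepsilon\tilde c(\varepsilon)\sin\psi+\varepsilon\gamma(t)z\right),\qquad \dot z=\varepsilon\gamma(t)\dot\psi$$ on the level set $\frac{\dot\psi^2}{2}-4\varepsilon\tilde c(\varepsilon)(1-\cos\psi)-2z^2=d$, where solutions differing by adding an integer multiple of $2\pi$ to $\psi$ are identified.
   Context: Along every solution of the system the quantity $\frac{\dot\psi^2}{2}-4\varepsilon\tilde c(\varepsilon)(1-\cos\psi)-2z^2$ is constant; the number $d$ is the fixed value of this first integral. A solution $(\psi,z)$ is $1$-periodic if both $\psi$ and $z$ are $1$-periodic functions on $\mathbb R$. *)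

theory Defs
  imports "HOL-Analysis.Analysis"
begin

text \<open>Meant for open \<open>S\<close>: as in \<^const>\<open>C1_differentiable_on\<close>, the derivatives are two-sided.\<close>

definition C2_differentiable_on :: "(real \<Rightarrow> real) \<Rightarrow> real set \<Rightarrow> bool"
    (infix \<open>C2'_differentiable'_on\<close> 50)
  where
  "f C2_differentiable_on S \<longleftrightarrow>
     (\<exists>D. (\<forall>x\<in>S. (f has_real_derivative D x) (at x)) \<and> D C1_differentiable_on S)"

text \<open>In the next three definitions the number \<open>c\<close> is the value of the coefficient function at \<open>\<epsilon>\<close>. The differentiability of \<open>\<psi>\<close> is
  required explicitly, because \<^const>\<open>deriv\<close> is arbitrary where no derivative exists.\<close>

definition is_solution ::
  "(real \<Rightarrow> real) \<Rightarrow> real \<Rightarrow> real \<Rightarrow> (real \<Rightarrow> real) \<times> (real \<Rightarrow> real) \<Rightarrow> bool"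
  where
  "is_solution \<gamma> c \<epsilon> = (\<lambda>(\<psi>, z).
     (\<forall>t. (\<psi> has_real_derivative deriv \<psi> t) (at t)) \<and>
     (\<forall>t. (deriv \<psi> has_real_derivative 4 * (\<epsilon> * c * sin (\<psi> t) + \<epsilon> * \<gamma> t * z t)) (at t)) \<and>
     (\<forall>t. (z has_real_derivative \<epsilon> * \<gamma> t * deriv \<psi> t) (at t)))"

definition first_integral ::
  "real \<Rightarrow> real \<Rightarrow> (real \<Rightarrow> real) \<times> (real \<Rightarrow> real) \<Rightarrow> real \<Rightarrow> real"
  where
  "first_integral c \<epsilon> = (\<lambda>(\<psi>, z) t.
     (deriv \<psi> t)\<^sup>2 / 2 - 4 * \<epsilon> * c * (1 - cos (\<psi> t)) - 2 * (z t)\<^sup>2)"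

definition periodic_solutions ::
  "(real \<Rightarrow> real) \<Rightarrow> real \<Rightarrow> real \<Rightarrow> real \<Rightarrow> ((real \<Rightarrow> real) \<times> (real \<Rightarrow> real)) set"
  where
  "periodic_solutions \<gamma> c d \<epsilon> =
     {(\<psi>, z). is_solution \<gamma> c \<epsilon> (\<psi>, z) \<and>
        (\<forall>t. first_integral c \<epsilon> (\<psi>, z) t = d) \<and>
        periodic_fun_simple' \<psi> \<and> periodic_fun_simple' z}"

definition shift_2pi ::
  "(((real \<Rightarrow> real) \<times> (real \<Rightarrow> real)) \<times> ((real \<Rightarrow> real) \<times> (real \<Rightarrow> real))) set"
  where
  "shift_2pi =
     {((\<psi>\<^sub>1, z\<^sub>1), (\<psi>\<^sub>2, z\<^sub>2)).
        (\<exists>k::int. \<forall>t. \<psi>\<^sub>2 t = \<psi>\<^sub>1 t + 2 * pi * of_int k) \<and> z\<^sub>2 = z\<^sub>1}"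

lemma equiv_shift_2pi: "equiv UNIV shift_2pi"
proof (rule equivI)
  show "refl shift_2pi"
    unfolding refl_on_def shift_2pi_def by (auto intro!: exI[of _ "0::int"])
  show "sym shift_2pi"
  proof (rule symI)
    fix x y assume "(x, y) \<in> shift_2pi"
    then obtain k :: int where "\<forall>t. fst y t = fst x t + 2 * pi * of_int k" "snd y = snd x"
      unfolding shift_2pi_def by auto
    then show "(y, x) \<in> shift_2pi"
      unfolding shift_2pi_def by (auto simp: case_prod_beta intro!: exI[of _ "-k"])
  qed
  show "trans shift_2pi"
  proof (rule transI)
    fix x y w assume "(x, y) \<in> shift_2pi" "(y, w) \<in> shift_2pi"
    then obtain k l :: int where "\<forall>t. fst y t = fst x t + 2 * pi * of_int k" "snd y = snd x"
      "\<forall>t. fst w t = fst y t + 2 * pi * of_int l" "snd w = snd y"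
      unfolding shift_2pi_def by auto
    then show "(x, w) \<in> shift_2pi"
      unfolding shift_2pi_def
      by (auto simp: case_prod_beta algebra_simps intro!: exI[of _ "k + l"])
  qed
qed auto

end

theory Submission
  imports Defs
begin

text \<open>Put \<open>m = sqrt (- d / 2)\<close>. On a periodic orbit \<open>\<psi>'\<close> vanishes somewhere, and the first integral then forces
  \<open>\<psi>' = O(\<epsilon>)\<close> and \<open>z = \<plusminus> m + O(\<epsilon>)\<close>, with a constant sign. Averaging the equation for \<open>\<psi>\<close> over a period gives
  \<open>c sin (\<psi> 0) = - z 0 * mean \<gamma> + O(\<epsilon>)\<close>, an equation with two nondegenerate roots modulo \<open>2 * pi\<close> for each sign of
  \<open>z\<close>. Taking \<open>a = \<psi> 0\<close> and the periodic function \<open>w = \<psi>' / \<epsilon>\<close> as unknowns, and fixing the sign \<open>s\<close> of \<open>z\<close> and the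
  branch \<open>r\<close> of the inverse sine, the periodic problem becomes the fixed point equation of a map with Lipschitz constant
  \<open>O(\<epsilon>)\<close>, which has exactly one solution by Banach's theorem. Primitives are taken after subtracting the
  mean, which keeps all functions periodic; the mean \<open>\<mu>\<close> subtracted in the equation for \<open>z\<close> vanishes at the fixed point, because
  otherwise the first integral would be strictly monotone along a periodic curve, as \<open>z\<close> does not change sign.\<close>

section \<open>Continuous 1-periodic functions\<close>

definition periodic_continuous :: "(real \<Rightarrow> real) \<Rightarrow> bool"
  where "periodic_continuous f \<longleftrightarrow> continuous_on UNIV f \<and> periodic_fun_simple' f"

lemma periodic_continuousI:
  "continuous_on UNIV f \<Longrightarrow> (\<And>t. f (t + 1) = f t) \<Longrightarrow> periodic_continuous f"
  by (simp add: periodic_continuous_def periodic_fun_simple'_def)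

lemma periodic_continuousD:
  assumes "periodic_continuous f"
  shows "continuous_on S f" "f (t + 1) = f t"
  using assms continuous_on_subset
  by (auto simp: periodic_continuous_def periodic_fun_simple'_def)

lemma periodic_continuous_add [intro]:
  "periodic_continuous f \<Longrightarrow> periodic_continuous g \<Longrightarrow> periodic_continuous (\<lambda>t. f t + g t)"
  by (auto intro!: periodic_continuousI continuous_intros simp: periodic_continuousD)

lemma periodic_continuous_diff [intro]:
  "periodic_continuous f \<Longrightarrow> periodic_continuous g \<Longrightarrow> periodic_continuous (\<lambda>t. f t - g t)"
  by (auto intro!: periodic_continuousI continuous_intros simp: periodic_continuousD)

lemma periodic_continuous_mult [intro]:
  "periodic_continuous f \<Longrightarrow> periodic_continuous g \<Longrightarrow> periodic_continuous (\<lambda>t. f t * g t)"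
  by (auto intro!: periodic_continuousI continuous_intros simp: periodic_continuousD)

lemma periodic_continuous_const [intro]: "periodic_continuous (\<lambda>t. a)"
  by (auto intro!: periodic_continuousI)

lemma periodic_continuous_sin [intro]:
  "periodic_continuous f \<Longrightarrow> periodic_continuous (\<lambda>t. sin (f t))"
  by (auto intro!: periodic_continuousI continuous_intros simp: periodic_continuousD)

lemma periodic_fun_frac:
  fixes f :: "real \<Rightarrow> 'a"
  assumes "periodic_fun_simple' f"
  shows "f (frac t) = f t"
proof -
  interpret periodic_fun_simple' f by fact
  show ?thesis using plus_of_int[of "frac t" "\<lfloor>t\<rfloor>"] by (simp add: frac_def)
qed

lemma frac_mem_unit: "frac (t :: real) \<in> {0..1}"
  using frac_lt_1[of t] by (simp add: less_imp_le)

lemma periodic_continuous_attains_max: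
  assumes "periodic_continuous f"
  obtains t0 where "t0 \<in> {0..1}" "\<And>t. \<bar>f t\<bar> \<le> \<bar>f t0\<bar>"
proof -
  have "continuous_on {0..1} (\<lambda>t. \<bar>f t\<bar>)"
    by (intro continuous_intros periodic_continuousD assms)
  then obtain t0 where t0: "t0 \<in> {0..1}" "\<forall>t\<in>{0..1}. \<bar>f t\<bar> \<le> \<bar>f t0\<bar>"
    using continuous_attains_sup[of "{0..1::real}" "\<lambda>t. \<bar>f t\<bar>"] by auto
  have "\<bar>f t\<bar> \<le> \<bar>f t0\<bar>" for t
    using bspec[OF t0(2) frac_mem_unit[of t]] assms
    by (simp add: periodic_fun_frac periodic_continuous_def)
  with t0(1) show thesis by (rule that)
qed

section \<open>Means over a period and mean-free primitives\<close>

abbreviation mean :: "(real \<Rightarrow> real) \<Rightarrow> real"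
  where "mean f \<equiv> integral {0..1} f"

lemma continuous_on_UNIV_integrable:
  fixes f :: "real \<Rightarrow> real"
  shows "continuous_on UNIV f \<Longrightarrow> f integrable_on {a..b}"
  using continuous_on_subset integrable_continuous_real by blast

lemma mean_add:
  "continuous_on UNIV f \<Longrightarrow> continuous_on UNIV g \<Longrightarrow> mean (\<lambda>t. f t + g t) = mean f + mean g"
  by (simp add: integral_add continuous_on_UNIV_integrable)

lemma mean_diff_le:
  assumes "continuous_on UNIV f" "continuous_on UNIV g" "\<And>t. \<bar>f t - g t\<bar> \<le> D"
  shows "\<bar>mean f - mean g\<bar> \<le> D"
proof -
  have "mean f - mean g = mean (\<lambda>t. f t - g t)"
    by (simp add: integral_diff continuous_on_UNIV_integrable assms)
  also have "norm \<dots> \<le> D * (1 - 0)"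
    by (rule integral_bound) (use assms in \<open>auto intro!: continuous_intros intro: continuous_on_subset\<close>)
  finally show ?thesis by simp
qed

lemma mean_le: "continuous_on UNIV f \<Longrightarrow> (\<And>t. \<bar>f t\<bar> \<le> D) \<Longrightarrow> \<bar>mean f\<bar> \<le> D"
  using mean_diff_le[of f "\<lambda>t. 0" D] by simp

lemma mean_deriv:
  fixes F f :: "real \<Rightarrow> real"
  assumes "\<And>t. (F has_real_derivative f t) (at t)"
  shows "mean f = F 1 - F 0"
proof (rule integral_unique)
  show "(f has_integral F 1 - F 0) {0..1}"
    by (rule fundamental_theorem_of_calculus)
      (auto intro: assms has_field_derivative_at_within
         simp flip: has_real_derivative_iff_has_vector_derivative)
qed

text \<open>Specified by its derivative on the whole line, since \<open>integral {0..t} f\<close> is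
  0 for negative \<open>t\<close>. It is the integrand that is freed of its mean; the primitive is
  normalised by its value at 0 and may have a nonzero mean.\<close>

definition mean_free_primitive :: "(real \<Rightarrow> real) \<Rightarrow> real \<Rightarrow> real"
  where "mean_free_primitive f =
    (SOME F. F 0 = 0 \<and> (\<forall>t. (F has_real_derivative f t - mean f) (at t)))"

lemma mean_free_primitive:
  assumes "continuous_on UNIV f"
  shows "mean_free_primitive f 0 = 0"
    "(mean_free_primitive f has_real_derivative f t - mean f) (at t)"
proof -
  \<comment> \<open>The infinite endpoints make this an antiderivative on the whole real
    line.\<close>
  have "\<exists>F. \<forall>x::real. - \<infinity> < ereal x \<longrightarrow> ereal x < \<infinity> \<longrightarrow>
      (F has_vector_derivative f x - mean f) (at x)"
    by (rule einterval_antiderivative)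
       (use assms in \<open>auto simp: continuous_on_eq_continuous_at intro!: continuous_intros\<close>)
  then obtain F where F: "\<And>x. (F has_real_derivative f x - mean f) (at x)"
    by (auto simp: has_real_derivative_iff_has_vector_derivative)
  have "\<exists>F. F 0 = 0 \<and> (\<forall>t. (F has_real_derivative f t - mean f) (at t))"
    by (rule exI[of _ "\<lambda>t. F t - F 0"]) (auto intro!: derivative_eq_intros F)
  from someI_ex[OF this]
  show "mean_free_primitive f 0 = 0"
    "(mean_free_primitive f has_real_derivative f t - mean f) (at t)"
    by (auto simp: mean_free_primitive_def)
qed

lemma eq_of_same_derivative:
  fixes F G f :: "real \<Rightarrow> real"
  assumes "\<And>t. (F has_real_derivative f t) (at t)" "\<And>t. (G has_real_derivative f t) (at t)"
    and "F a = G a"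
  shows "F t = G t"
proof -
  have "((\<lambda>t. F t - G t) has_real_derivative 0) (at t)" for t
    by (auto intro!: derivative_eq_intros assms)
  then have "F t - G t = F a - G a"
    by (intro DERIV_isconst_all[rule_format]) auto
  then show ?thesis using assms by simp
qed

lemma mean_free_primitive_eqI:
  assumes "continuous_on UNIV f" "\<And>t. (F has_real_derivative f t - mean f) (at t)"
  shows "mean_free_primitive f = (\<lambda>t. F t - F 0)"
proof
  fix t
  show "mean_free_primitive f t = F t - F 0"
    by (rule eq_of_same_derivative[where a = 0])
       (auto intro!: derivative_eq_intros mean_free_primitive assms)
qed

lemma mean_free_primitive_1:
  assumes "continuous_on UNIV f"
  shows "mean_free_primitive f 1 = 0"
proof -
  have "mean (\<lambda>t. f t - mean f) = mean_free_primitive f 1 - mean_free_primitive f 0"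
    by (rule mean_deriv) (rule mean_free_primitive[OF assms])
  moreover have "mean (\<lambda>t. f t - mean f) = 0"
    by (simp add: integral_diff continuous_on_UNIV_integrable assms)
  ultimately show ?thesis by (simp add: mean_free_primitive assms)
qed

text \<open>Over one period the primitive grows by the integral of \<open>f t - mean f\<close>,
  which is 0. Hence it and its translate by 1 agree at 0, and their derivatives agree
  everywhere.\<close>

lemma periodic_continuous_mean_free_primitive:
  assumes f: "periodic_continuous f"
  shows "periodic_continuous (mean_free_primitive f)"
proof (rule periodic_continuousI)
  note c = periodic_continuousD(1)[OF f]
  show "continuous_on UNIV (mean_free_primitive f)"
    using mean_free_primitive(2)[OF c] DERIV_isCont continuous_at_imp_continuous_on by blast
  fix t
  have D: "((\<lambda>t. mean_free_primitive f (t + 1)) has_real_derivative f t - mean f) (at t)" for t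
  proof -
    have "((\<lambda>t. mean_free_primitive f (t + 1)) has_real_derivative (f (t + 1) - mean f) * 1) (at t)"
      by (rule DERIV_chain2[OF mean_free_primitive(2)[OF c]]) (auto intro!: derivative_eq_intros)
    then show ?thesis by (simp add: periodic_continuousD(2)[OF f])
  qed
  show "mean_free_primitive f (t + 1) = mean_free_primitive f t"
    by (rule eq_of_same_derivative[where a = 0, OF D mean_free_primitive(2)[OF c]])
       (simp add: mean_free_primitive[OF c] mean_free_primitive_1[OF c])
qed

text \<open>The derivative of the difference is at most \<open>2 * D\<close>: once \<open>D\<close>
  for the integrands and once for their means. Periodicity replaces \<open>t\<close> by
  \<open>frac t\<close>, which is at distance at most 1 from the common zero 0.\<close>

lemma mean_free_primitive_diff_le:
  assumes f: "periodic_continuous f" and g: "periodic_continuous g"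
    and D: "\<And>t. \<bar>f t - g t\<bar> \<le> D"
  shows "\<bar>mean_free_primitive f t - mean_free_primitive g t\<bar> \<le> 2 * D"
proof -
  note cf = periodic_continuousD(1)[OF f] and cg = periodic_continuousD(1)[OF g]
  let ?H = "\<lambda>t. mean_free_primitive f t - mean_free_primitive g t"
  have "norm (?H (frac t) - ?H 0) \<le> 2 * D * norm (frac t - 0)"
  proof (rule field_differentiable_bound[where S = UNIV])
    show "(?H has_real_derivative (f t - mean f) - (g t - mean g)) (at t within UNIV)" for t
      by (intro DERIV_diff mean_free_primitive cf cg)
    show "norm ((f t - mean f) - (g t - mean g)) \<le> 2 * D" for t
      using D[of t] mean_diff_le[OF cf cg D] by simp
  qed auto
  also have "\<dots> \<le> 2 * D * 1"
    using frac_lt_1[of t] D[of 0] by (intro mult_left_mono) auto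
  finally have "\<bar>?H (frac t)\<bar> \<le> 2 * D"
    by (simp add: mean_free_primitive cf cg)
  moreover have "mean_free_primitive f (frac t) = mean_free_primitive f t"
    "mean_free_primitive g (frac t) = mean_free_primitive g t"
    using periodic_continuous_mean_free_primitive[OF f] periodic_continuous_mean_free_primitive[OF g]
    by (simp_all add: periodic_continuous_def periodic_fun_frac)
  ultimately show ?thesis by simp
qed

lemma mean_free_primitive_le:
  assumes f: "periodic_continuous f" and D: "\<And>t. \<bar>f t\<bar> \<le> D"
  shows "\<bar>mean_free_primitive f t\<bar> \<le> 2 * D"
proof -
  have "mean_free_primitive (\<lambda>t. 0) = (\<lambda>t. 0 - 0)"
    by (rule mean_free_primitive_eqI) auto
  with mean_free_primitive_diff_le[OF f periodic_continuous_const[of 0], of D t] D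
  show ?thesis by simp
qed

text \<open>The second derivative supplies continuity of \<open>f'\<close>; uniqueness of
  derivatives, applied to \<open>f\<close> and its translate, supplies periodicity.\<close>

lemma periodic_continuous_deriv:
  fixes f f' :: "real \<Rightarrow> real"
  assumes per: "periodic_fun_simple' f" and f: "\<And>t. (f has_real_derivative f' t) (at t)"
    and f': "\<And>t. (f' has_real_derivative f'' t) (at t)"
  shows "periodic_continuous f'"
proof (rule periodic_continuousI)
  show "continuous_on UNIV f'"
    using f' DERIV_isCont continuous_at_imp_continuous_on by blast
  fix t
  have "((\<lambda>t. f (t + 1)) has_real_derivative f' (t + 1) * 1) (at t)"
    by (rule DERIV_chain2[OF f]) (auto intro!: derivative_eq_intros)
  moreover have "(\<lambda>t. f (t + 1)) = f"
    using per by (auto simp: periodic_fun_simple'_def)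
  ultimately show "f' (t + 1) = f' t"
    using f[of t] DERIV_unique by fastforce
qed

section \<open>Lipschitz estimates for arcsine, square root and sine\<close>

lemma arcsin_lipschitz:
  assumes "0 < q" "q < 1" "\<bar>x\<bar> \<le> q" "\<bar>y\<bar> \<le> q"
  shows "\<bar>arcsin x - arcsin y\<bar> \<le> \<bar>x - y\<bar> / sqrt (1 - q\<^sup>2)"
proof -
  have "norm (arcsin x - arcsin y) \<le> (1 / sqrt (1 - q\<^sup>2)) * norm (x - y)"
  proof (rule field_differentiable_bound[where S = "{-q..q}"])
    fix z assume z: "z \<in> {-q..q}"
    show "(arcsin has_real_derivative inverse (sqrt (1 - z\<^sup>2))) (at z within {-q..q})"
      using z assms by (intro DERIV_subset[OF DERIV_arcsin]) auto
    have "z\<^sup>2 \<le> q\<^sup>2" using z by (simp add: abs_le_square_iff[symmetric] abs_le_iff)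
    \<comment> \<open>Staying within \<open>q < 1\<close> avoids the points 1 and -1, where the
      derivative of \<open>arcsin\<close> blows up.\<close>
    moreover have "q\<^sup>2 < 1" using assms by (simp add: abs_square_less_1)
    ultimately show "norm (inverse (sqrt (1 - z\<^sup>2))) \<le> 1 / sqrt (1 - q\<^sup>2)"
      by (simp add: field_simps)
  qed (use assms in \<open>auto simp: abs_le_iff\<close>)
  then show ?thesis by simp
qed

text \<open>The difference of the roots times their sum is \<open>x - y\<close>, and each root is at
  least \<open>m / 2\<close>.\<close>

lemma sqrt_diff_le:
  assumes "m > 0" "m\<^sup>2 / 4 \<le> x" "m\<^sup>2 / 4 \<le> y"
  shows "\<bar>sqrt x - sqrt y\<bar> \<le> \<bar>x - y\<bar> / m"
proof -
  have m: "m / 2 \<le> sqrt v" if "m\<^sup>2 / 4 \<le> v" for v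
    using that assms(1) by (intro real_le_rsqrt) (simp add: power2_eq_square)
  have "m \<le> sqrt x + sqrt y" using m[of x] m[of y] assms by simp
  have nn: "x \<ge> 0" "y \<ge> 0" using assms zero_le_power2[of m] by linarith+
  have "\<bar>sqrt x - sqrt y\<bar> * m \<le> \<bar>sqrt x - sqrt y\<bar> * \<bar>sqrt x + sqrt y\<bar>"
    using \<open>m \<le> sqrt x + sqrt y\<close> by (intro mult_left_mono) auto
  also have "\<dots> = \<bar>(sqrt x - sqrt y) * (sqrt x + sqrt y)\<bar>" by (simp only: abs_mult)
  also have "(sqrt x - sqrt y) * (sqrt x + sqrt y) = x - y"
    using nn by (simp add: algebra_simps)
  finally show ?thesis using assms(1) by (simp add: field_simps)
qed

lemma abs_sin_diff_le: "\<bar>sin x - sin y\<bar> \<le> \<bar>x - y\<bar>" for x y :: real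
  using field_differentiable_bound[of UNIV sin cos 1 x y] DERIV_sin by auto

lemma abs_cos_diff_le: "\<bar>cos x - cos y\<bar> \<le> \<bar>x - y\<bar>" for x y :: real
  using field_differentiable_bound[of UNIV cos "\<lambda>x. - sin x" 1 x y] DERIV_cos by auto

text \<open>The increment of sine is the product \<open>2 sin (h/2) cos (a + h/2)\<close>, whose first factor is small with \<open>h\<close>.\<close>

lemma sin_increment_lipschitz:
  fixes a b h k D M e :: real
  assumes "\<bar>a - b\<bar> \<le> D" "\<bar>h - k\<bar> \<le> 2 * e * D" "\<bar>k\<bar> \<le> 2 * e * M" "0 \<le> e" "e \<le> 1"
  shows "\<bar>(sin (a + h) - sin a) - (sin (b + k) - sin b)\<bar> \<le> 2 * e * (1 + 2 * M) * D"
proof -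
  have eq: "sin (a + h) - sin a = 2 * (sin (h / 2) * cos (a + h / 2))" for a h :: real
  proof -
    have "(a + h + a) / 2 = a + h / 2" by (simp add: field_simps)
    then show ?thesis using sin_diff_sin[of "a + h" a] by (simp only: mult.assoc) simp
  qed
  have D: "0 \<le> D" using assms(1) by linarith
  have eD: "0 \<le> e * D" "e * D \<le> D" using D assms by (auto simp: mult_left_le_one_le)
  have eM: "0 \<le> e * M" using assms(3) by linarith
  have "\<bar>sin (h / 2) * cos (a + h / 2) - sin (k / 2) * cos (b + k / 2)\<bar>
      = \<bar>(sin (h / 2) - sin (k / 2)) * cos (a + h / 2)
         + sin (k / 2) * (cos (a + h / 2) - cos (b + k / 2))\<bar>"
    by (simp add: algebra_simps)
  also have "\<dots> \<le> \<bar>sin (h / 2) - sin (k / 2)\<bar> * \<bar>cos (a + h / 2)\<bar>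
         + \<bar>sin (k / 2)\<bar> * \<bar>cos (a + h / 2) - cos (b + k / 2)\<bar>"
    by (rule order_trans[OF abs_triangle_ineq]) (simp add: abs_mult)
  also have "\<dots> \<le> (e * D) * 1 + (e * M) * (2 * D)"
  proof (intro add_mono mult_mono)
    show "\<bar>sin (h / 2) - sin (k / 2)\<bar> \<le> e * D"
      using abs_sin_diff_le[of "h / 2" "k / 2"] assms(2) by simp
    show "\<bar>sin (k / 2)\<bar> \<le> e * M" using abs_sin_diff_le[of "k / 2" 0] assms(3) by simp
    \<comment> \<open>The arguments differ by at most \<open>D + e * D\<close>, and
      \<open>e \<le> 1\<close>.\<close>
    show "\<bar>cos (a + h / 2) - cos (b + k / 2)\<bar> \<le> 2 * D"
      using abs_cos_diff_le[of "a + h / 2" "b + k / 2"] assms(1,2) eD by linarith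
  qed (use eD eM in auto)
  finally show ?thesis unfolding eq by (simp add: algebra_simps)
qed

section \<open>Constants and smallness conditions\<close>

text \<open>Here \<open>c\<close> is the value of the coefficient at \<open>\<epsilon>\<close>,
  squeezed between \<open>k\<close> and \<open>C\<close>; \<open>M\<close> will bound
  \<open>w\<close>, and \<open>q\<close> the argument of \<open>arcsin\<close>. The condition
  \<open>\<epsilon>\<Gamma>m\<close> preserves the sign of \<open>z\<close>,
  \<open>\<epsilon>C\<close> keeps the radicand away from 0, \<open>nondegenerate\<close> keeps the
  argument of \<open>arcsin\<close> within \<open>q\<close>, and \<open>contraction\<close> yields
  the Lipschitz constant 1/2.\<close>

locale small_epsilon =
  fixes \<gamma> :: "real \<Rightarrow> real" and c \<epsilon> m \<Gamma> C k q M :: real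
  assumes \<gamma>: "periodic_continuous \<gamma>" and \<gamma>_le: "\<And>t. \<bar>\<gamma> t\<bar> \<le> \<Gamma>"
    and m_pos: "0 < m" and k_pos: "0 < k" and k_le: "k \<le> c" and c_le: "c \<le> C"
    and \<epsilon>_pos: "0 < \<epsilon>" and \<epsilon>_le: "\<epsilon> \<le> 1" and q_pos: "0 < q" and q_less: "q < 1"
    and M_eq: "M = 16 * (2 * C + \<Gamma> * (m + 1))"
    and \<epsilon>M: "\<epsilon> * M \<le> 1" and \<epsilon>\<Gamma>m: "8 * \<epsilon> * \<Gamma> \<le> m" and \<epsilon>\<Gamma>: "4 * \<epsilon> * \<Gamma> \<le> 1"
    and \<epsilon>C: "16 * \<epsilon> * C \<le> 3 * m\<^sup>2"
    and nondegenerate: "m * \<bar>mean \<gamma>\<bar> + \<epsilon> * M * (2 * C + \<Gamma> + 2 * \<Gamma>\<^sup>2) \<le> q * c"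
    and contraction:
      "\<epsilon> * (2 * C * (1 + 2 * M) + \<Gamma> * ((M + 2 * C) / m + 2 * \<Gamma>)) * (1 / (k * sqrt (1 - q\<^sup>2)) + 16) \<le> 1 / 2"
begin

section \<open>The periodic problem as a fixed point map\<close>

lemma c_pos: "0 < c" and C_pos: "0 < C" and \<Gamma>_nonneg: "0 \<le> \<Gamma>"
  using k_pos k_le c_le \<gamma>_le[of 0] by linarith+

lemma M_pos: "0 < M"
  using C_pos \<Gamma>_nonneg m_pos by (simp add: M_eq add_pos_nonneg)

text \<open>In terms of \<open>a = \<psi> 0\<close> and \<open>w = \<psi>' / \<epsilon>\<close>, where \<open>w\<close> has mean zero: \<open>initial_z\<close> is \<open>z 0\<close> as forced
  by the first integral, the flag \<open>s\<close> being its sign, and \<open>forcing\<close> is \<open>\<psi>'' / (4 * \<epsilon>)\<close> up to the constant \<open>c * sin a\<close>.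
  Taking this constant out makes the forcing depend on \<open>(a, w)\<close> with Lipschitz constant \<open>O(\<epsilon>)\<close>.\<close>

definition radicand :: "real \<Rightarrow> (real \<Rightarrow> real) \<Rightarrow> real"
  where "radicand a w = m\<^sup>2 + \<epsilon>\<^sup>2 * (w 0)\<^sup>2 / 4 - 2 * \<epsilon> * c * (1 - cos a)"

definition initial_z :: "bool \<Rightarrow> real \<Rightarrow> (real \<Rightarrow> real) \<Rightarrow> real"
  where "initial_z s a w = (if s then 1 else -1) * sqrt (radicand a w)"

definition path_\<psi> :: "real \<Rightarrow> (real \<Rightarrow> real) \<Rightarrow> real \<Rightarrow> real"
  where "path_\<psi> a w t = a + \<epsilon> * mean_free_primitive w t"

definition path_z :: "bool \<Rightarrow> real \<Rightarrow> (real \<Rightarrow> real) \<Rightarrow> real \<Rightarrow> real"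
  where "path_z s a w t =
    initial_z s a w + \<epsilon>\<^sup>2 * mean_free_primitive (\<lambda>t. \<gamma> t * w t) t"

definition forcing :: "bool \<Rightarrow> real \<Rightarrow> (real \<Rightarrow> real) \<Rightarrow> real \<Rightarrow> real"
  where "forcing s a w t = c * (sin (path_\<psi> a w t) - sin a) + \<gamma> t * path_z s a w t"

text \<open>For arguments strictly between -1 and 1 these are the two inverse values of sine modulo
  \<open>2 * pi\<close>; \<open>r\<close> is the sign of their cosine.\<close>

definition branch :: "bool \<Rightarrow> real \<Rightarrow> real"
  where "branch r x = (if r then arcsin x else pi - arcsin x)"

text \<open>At a fixed point this says \<open>c * sin a + mean (forcing s a w) = 0\<close>, the
  condition for the derivative of \<open>w\<close> to have mean zero.\<close>

definition next_a :: "bool \<Rightarrow> bool \<Rightarrow> real \<Rightarrow> (real \<Rightarrow> real) \<Rightarrow> real"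
  where "next_a s r a w = branch r (- mean (forcing s a w) / c)"

text \<open>The factor 4 is that of the equation for \<open>\<psi>\<close>. The outer mean is
  subtracted so that a fixed point \<open>w\<close> has mean zero, as the derivative of a periodic
  function must.\<close>

definition next_w :: "bool \<Rightarrow> real \<Rightarrow> (real \<Rightarrow> real) \<Rightarrow> real \<Rightarrow> real"
  where "next_w s a w t = 4 * (mean_free_primitive (forcing s a w) t
     - mean (mean_free_primitive (forcing s a w)))"

definition admissible :: "(real \<Rightarrow> real) \<Rightarrow> bool"
  where "admissible w \<longleftrightarrow> periodic_continuous w \<and> (\<forall>t. \<bar>w t\<bar> \<le> M)"

lemma admissibleD:
  assumes "admissible w"
  shows "periodic_continuous w" "\<bar>w t\<bar> \<le> M"
  using assms by (auto simp: admissible_def)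

section \<open>A priori bounds and invariance of the admissible functions\<close>

lemma periodic_continuous_path_\<psi>:
  "periodic_continuous w \<Longrightarrow> periodic_continuous (path_\<psi> a w)"
  unfolding path_\<psi>_def
  by (intro periodic_continuous_add periodic_continuous_mult periodic_continuous_const
      periodic_continuous_mean_free_primitive)

lemma periodic_continuous_path_z:
  "periodic_continuous w \<Longrightarrow> periodic_continuous (path_z s a w)"
  unfolding path_z_def
  by (intro periodic_continuous_add periodic_continuous_mult periodic_continuous_const
      periodic_continuous_mean_free_primitive \<gamma>)

lemma periodic_continuous_forcing:
  "periodic_continuous w \<Longrightarrow> periodic_continuous (forcing s a w)"
  unfolding forcing_def
  by (intro periodic_continuous_add periodic_continuous_diff periodic_continuous_mult
      periodic_continuous_const periodic_continuous_sin
      periodic_continuous_path_\<psi> periodic_continuous_path_z \<gamma>)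

lemma \<gamma>_mult_le: "\<bar>x\<bar> \<le> B \<Longrightarrow> \<bar>\<gamma> t * x\<bar> \<le> \<Gamma> * B"
  unfolding abs_mult using \<gamma>_le[of t] \<Gamma>_nonneg by (intro mult_mono) auto

lemma c_mult_le: "\<bar>x\<bar> \<le> B \<Longrightarrow> \<bar>c * x\<bar> \<le> C * B"
  unfolding abs_mult using c_pos c_le by (intro mult_mono) auto

lemma \<epsilon>_mult_le: "0 \<le> x \<Longrightarrow> \<epsilon> * x \<le> x"
  using \<epsilon>_le \<epsilon>_pos by (simp add: mult_left_le_one_le)

lemma \<epsilon>2_mult_le: "0 \<le> x \<Longrightarrow> \<epsilon>\<^sup>2 * x \<le> \<epsilon> * x"
  using \<epsilon>_mult_le[of "\<epsilon> * x"] \<epsilon>_pos by (simp add: power2_eq_square mult.assoc)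

text \<open>The subtracted cosine term is at most \<open>4 * \<epsilon> * C\<close>, which
  \<open>\<epsilon>C\<close> bounds by three quarters of the square of \<open>m\<close>.\<close>

lemma radicand_ge: "m\<^sup>2 / 4 \<le> radicand a w"
proof -
  have "\<epsilon> * c * (1 - cos a) \<le> (\<epsilon> * C) * 2"
    using c_le \<epsilon>_pos C_pos c_pos cos_ge_minus_one[of a] by (intro mult_mono) auto
  moreover have "0 \<le> \<epsilon>\<^sup>2 * (w 0)\<^sup>2 / 4" by simp
  ultimately show ?thesis using \<epsilon>C unfolding radicand_def by linarith
qed

lemma initial_z_sign:
  "s \<Longrightarrow> m / 2 \<le> initial_z s a w" "\<not> s \<Longrightarrow> initial_z s a w \<le> - m / 2"
proof -
  have "m / 2 \<le> sqrt (radicand a w)"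
    using radicand_ge[of a w] by (intro real_le_rsqrt) (simp add: power_divide)
  then show "s \<Longrightarrow> m / 2 \<le> initial_z s a w" "\<not> s \<Longrightarrow> initial_z s a w \<le> - m / 2"
    by (auto simp: initial_z_def)
qed

lemma initial_z_square: "(initial_z s a w)\<^sup>2 = radicand a w"
proof -
  have "0 \<le> radicand a w" using radicand_ge[of a w] zero_le_power2[of m] by linarith
  then show ?thesis by (simp add: initial_z_def power_mult_distrib)
qed

text \<open>The cosine term only lowers the radicand, and the square of the bound exceeds what
  remains by at least the cross term \<open>m * (\<epsilon> * M)\<close>.\<close>

lemma initial_z_le:
  assumes "\<bar>w 0\<bar> \<le> M"
  shows "\<bar>initial_z s a w\<bar> \<le> m + \<epsilon> * M / 2"
proof (rule power2_le_imp_le)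
  have "(w 0)\<^sup>2 \<le> M\<^sup>2" using assms M_pos by (simp add: abs_le_square_iff[symmetric])
  then have "\<epsilon>\<^sup>2 * (w 0)\<^sup>2 \<le> \<epsilon>\<^sup>2 * M\<^sup>2" by (rule mult_left_mono) simp
  moreover have "0 \<le> \<epsilon> * c * (1 - cos a)" using \<epsilon>_pos c_pos by simp
  moreover have "0 \<le> m * (\<epsilon> * M)" using m_pos \<epsilon>_pos M_pos by simp
  ultimately have "radicand a w \<le> (m + \<epsilon> * M / 2)\<^sup>2"
    unfolding radicand_def by (simp add: power2_sum power_mult_distrib power_divide)
  then show "\<bar>initial_z s a w\<bar>\<^sup>2 \<le> (m + \<epsilon> * M / 2)\<^sup>2" by (simp add: initial_z_square)
qed (use m_pos \<epsilon>_pos M_pos in simp)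

lemma path_\<psi>_increment_le:
  assumes "admissible w"
  shows "\<bar>\<epsilon> * mean_free_primitive w t\<bar> \<le> 2 * \<epsilon> * M"
  using mean_free_primitive_le[OF admissibleD(1,2)[OF assms], of t] \<epsilon>_pos
  by (simp add: abs_mult)

text \<open>The factor \<open>\<epsilon> * M\<close> is kept because \<open>mean_forcing_le\<close>
  needs it; the primed version replaces it by 1.\<close>

lemma path_z_increment_le:
  assumes "admissible w"
  shows "\<bar>path_z s a w t - initial_z s a w\<bar> \<le> 2 * \<epsilon> * \<Gamma> * (\<epsilon> * M)"
proof -
  have "\<bar>mean_free_primitive (\<lambda>t. \<gamma> t * w t) t\<bar> \<le> 2 * (\<Gamma> * M)"
    using admissibleD[OF assms]
    by (intro mean_free_primitive_le periodic_continuous_mult \<gamma> \<gamma>_mult_le)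
  then have "\<epsilon>\<^sup>2 * \<bar>mean_free_primitive (\<lambda>t. \<gamma> t * w t) t\<bar> \<le> \<epsilon>\<^sup>2 * (2 * (\<Gamma> * M))"
    by (rule mult_left_mono) simp
  then show ?thesis by (simp add: path_z_def abs_mult power2_eq_square algebra_simps)
qed

lemma path_z_increment_le':
  assumes "admissible w"
  shows "\<bar>path_z s a w t - initial_z s a w\<bar> \<le> 2 * \<epsilon> * \<Gamma>"
proof -
  have "2 * \<epsilon> * \<Gamma> * (\<epsilon> * M) \<le> 2 * \<epsilon> * \<Gamma> * 1"
    using \<epsilon>M \<epsilon>_pos \<Gamma>_nonneg by (intro mult_left_mono) auto
  then show ?thesis using path_z_increment_le[OF assms, of s a t] by linarith
qed

text \<open>The path moves by at most \<open>m / 4\<close> from a starting value of size at least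
  \<open>m / 2\<close>. The constant sign later forces \<open>\<mu> = 0\<close> and tells apart the
  solutions with different \<open>s\<close>.\<close>

lemma path_z_sign:
  assumes "admissible w"
  shows "s \<Longrightarrow> 0 < path_z s a w t" "\<not> s \<Longrightarrow> path_z s a w t < 0"
  using path_z_increment_le'[OF assms, of s a t] initial_z_sign[where s=s and a=a and w=w] \<epsilon>\<Gamma>m m_pos
  by linarith+

lemma path_z_le:
  assumes "admissible w"
  shows "\<bar>path_z s a w t\<bar> \<le> m + 1"
  using path_z_increment_le'[OF assms, of s a t] initial_z_le[of w s a] admissibleD(2)[OF assms, of 0] \<epsilon>\<Gamma> \<epsilon>M
  by linarith

lemma forcing_le:
  assumes "admissible w"
  shows "\<bar>forcing s a w t\<bar> \<le> M / 16"
proof -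
  have "\<bar>sin (path_\<psi> a w t) - sin a\<bar> \<le> 2"
    using abs_sin_le_one[of a] abs_sin_le_one[of "path_\<psi> a w t"] by linarith
  from c_mult_le[OF this] \<gamma>_mult_le[OF path_z_le[OF assms], of t s a t] show ?thesis
    unfolding forcing_def M_eq abs_le_iff by argo
qed

text \<open>Freezing \<open>z\<close> at its initial value and dropping the sine increment leaves
  \<open>initial_z s a w * mean \<gamma>\<close>, of size at most
  \<open>m * \<bar>mean \<gamma>\<bar>\<close> up to \<open>O(\<epsilon>)\<close>. The condition
  \<open>nondegenerate\<close> covers this and all errors.\<close>

lemma mean_forcing_le:
  assumes w: "admissible w"
  shows "\<bar>mean (forcing s a w)\<bar> \<le> q * c"
proof -
  let ?b = "initial_z s a w"
  have "\<bar>mean (forcing s a w) - mean (\<lambda>t. ?b * \<gamma> t)\<bar> \<le> \<epsilon> * M * (2 * C + 2 * \<Gamma>\<^sup>2)"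
  proof (rule mean_diff_le)
    show "continuous_on UNIV (forcing s a w)" "continuous_on UNIV (\<lambda>t. ?b * \<gamma> t)"
      using periodic_continuousD(1) periodic_continuous_forcing admissibleD(1)[OF w] \<gamma>
      by (auto intro!: continuous_intros)
    fix t
    have "\<bar>sin (path_\<psi> a w t) - sin a\<bar> \<le> 2 * \<epsilon> * M"
      using order_trans[OF abs_sin_diff_le[of "path_\<psi> a w t" a]] path_\<psi>_increment_le[OF w, of t]
      by (simp add: path_\<psi>_def)
    note c_mult_le[OF this]
    moreover have "\<epsilon> * M * (\<epsilon> * \<Gamma>\<^sup>2) \<le> \<epsilon> * M * \<Gamma>\<^sup>2"
      using \<epsilon>_pos M_pos by (intro mult_left_mono \<epsilon>_mult_le) auto
    moreover have "forcing s a w t - ?b * \<gamma> t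
        = c * (sin (path_\<psi> a w t) - sin a) + \<gamma> t * (path_z s a w t - ?b)"
      by (simp add: forcing_def algebra_simps)
    ultimately show "\<bar>forcing s a w t - ?b * \<gamma> t\<bar> \<le> \<epsilon> * M * (2 * C + 2 * \<Gamma>\<^sup>2)"
      using \<gamma>_mult_le[OF path_z_increment_le[OF w], of t s a t]
      by (simp add: algebra_simps power2_eq_square)
  qed
  moreover have "\<bar>mean (\<lambda>t. ?b * \<gamma> t)\<bar> \<le> m * \<bar>mean \<gamma>\<bar> + \<epsilon> * M * \<Gamma>"
  proof -
    have "\<bar>mean \<gamma>\<bar> \<le> \<Gamma>" using mean_le[OF periodic_continuousD(1)[OF \<gamma>] \<gamma>_le] .
    then have *: "\<epsilon> * M / 2 * \<bar>mean \<gamma>\<bar> \<le> \<epsilon> * M * \<Gamma>"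
      using \<epsilon>_pos M_pos \<Gamma>_nonneg by (intro mult_mono) auto
    have "\<bar>mean (\<lambda>t. ?b * \<gamma> t)\<bar> = \<bar>?b\<bar> * \<bar>mean \<gamma>\<bar>" by (simp add: abs_mult)
    also have "\<dots> \<le> (m + \<epsilon> * M / 2) * \<bar>mean \<gamma>\<bar>"
      by (intro mult_right_mono initial_z_le admissibleD[OF w]) auto
    finally show ?thesis using * by (simp add: algebra_simps)
  qed
  ultimately show ?thesis using nondegenerate by (simp add: algebra_simps)
qed

lemma mean_forcing_div_le:
  assumes "admissible w"
  shows "\<bar>- mean (forcing s a w) / c\<bar> \<le> q"
  using mean_forcing_le[OF assms, of s a] c_pos by (simp add: pos_divide_le_eq)

text \<open>This explains the 16 in \<open>M\<close>: the factor 4 of \<open>next_w\<close>, times 2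
  for the primitive plus 2 for its mean.\<close>

lemma admissible_next_w:
  assumes w: "admissible w"
  shows "admissible (next_w s a w)"
proof -
  let ?J = "mean_free_primitive (forcing s a w)"
  have J: "periodic_continuous ?J"
    using w by (intro periodic_continuous_mean_free_primitive periodic_continuous_forcing admissibleD)
  have le: "\<bar>?J t\<bar> \<le> 2 * (M / 16)" for t
    by (rule mean_free_primitive_le[OF periodic_continuous_forcing[OF admissibleD(1)[OF w]] forcing_le[OF w]])
  have "\<bar>mean ?J\<bar> \<le> 2 * (M / 16)"
    by (rule mean_le[OF periodic_continuousD(1)[OF J] le])
  then have "\<bar>next_w s a w t\<bar> \<le> M" for t
    using le[of t] M_pos unfolding next_w_def abs_le_iff by argo
  moreover have "periodic_continuous (next_w s a w)"
    unfolding next_w_def using J by (intro periodic_continuous_mult periodic_continuous_diff periodic_continuous_const)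
  ultimately show ?thesis by (simp add: admissible_def)
qed

section \<open>Contraction estimates\<close>

text \<open>Every dependence on \<open>(a, w)\<close> carries a factor \<open>\<epsilon>\<close>:
  the sine increment by \<open>sin_increment_lipschitz\<close>, \<open>initial_z\<close> through the
  variable terms of the radicand, and the increment of \<open>path_z\<close> through its explicit
  coefficient.\<close>

lemma forcing_diff_le:
  assumes v: "admissible v" and w: "admissible w"
    and D: "\<bar>a - b\<bar> \<le> D" "\<And>t. \<bar>v t - w t\<bar> \<le> D"
  shows "\<bar>forcing s a v t - forcing s b w t\<bar>
    \<le> \<epsilon> * (2 * C * (1 + 2 * M) + \<Gamma> * ((M + 2 * C) / m + 2 * \<Gamma>)) * D"
proof -
  note vp = admissibleD(1)[OF v] and wp = admissibleD(1)[OF w]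
  have D0: "0 \<le> D" using D(1) by linarith
  have "\<bar>mean_free_primitive v t - mean_free_primitive w t\<bar> \<le> 2 * D"
    using mean_free_primitive_diff_le[OF vp wp D(2)] .
  then have "\<bar>\<epsilon> * mean_free_primitive v t - \<epsilon> * mean_free_primitive w t\<bar> \<le> 2 * \<epsilon> * D"
    using \<epsilon>_pos by (simp add: right_diff_distrib[symmetric] abs_mult)
  from c_mult_le[OF sin_increment_lipschitz[OF D(1) this path_\<psi>_increment_le[OF w]]] \<epsilon>_pos \<epsilon>_le
  have sin: "\<bar>c * ((sin (path_\<psi> a v t) - sin a) - (sin (path_\<psi> b w t) - sin b))\<bar>
      \<le> C * (2 * \<epsilon> * (1 + 2 * M) * D)"
    by (simp add: path_\<psi>_def)
  have rad: "\<bar>radicand a v - radicand b w\<bar> \<le> \<epsilon> * (M + 2 * C) * D"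
  proof -
    have "\<bar>(v 0)\<^sup>2 - (w 0)\<^sup>2\<bar> = \<bar>v 0 - w 0\<bar> * \<bar>v 0 + w 0\<bar>"
      by (simp add: power2_eq_square abs_mult[symmetric] algebra_simps)
    also have "\<dots> \<le> D * (2 * M)"
      using D(2)[of 0] admissibleD(2)[OF v, of 0] admissibleD(2)[OF w, of 0] D0
      by (intro mult_mono) auto
    finally have "\<epsilon>\<^sup>2 * \<bar>(v 0)\<^sup>2 - (w 0)\<^sup>2\<bar> \<le> \<epsilon>\<^sup>2 * (D * (2 * M))"
      by (rule mult_left_mono) simp
    \<comment> \<open>One of the two factors \<open>\<epsilon>\<close> is given up, so that all
      contributions become linear in \<open>\<epsilon>\<close>.\<close>
    also have "\<dots> \<le> \<epsilon> * (D * (2 * M))" using D0 M_pos by (intro \<epsilon>2_mult_le) auto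
    finally have 1: "\<bar>\<epsilon>\<^sup>2 * ((v 0)\<^sup>2 - (w 0)\<^sup>2)\<bar> \<le> 2 * (\<epsilon> * M * D)"
      by (simp add: abs_mult mult_ac)
    have "\<bar>cos a - cos b\<bar> \<le> D" using abs_cos_diff_le[of a b] D(1) by linarith
    from c_mult_le[OF this] have "\<epsilon> * \<bar>c * (cos a - cos b)\<bar> \<le> \<epsilon> * (C * D)"
      using \<epsilon>_pos by (intro mult_left_mono) auto
    then have 2: "\<bar>\<epsilon> * (c * (cos a - cos b))\<bar> \<le> \<epsilon> * (C * D)"
      using \<epsilon>_pos by (simp add: abs_mult)
    have "radicand a v - radicand b w
        = \<epsilon>\<^sup>2 * ((v 0)\<^sup>2 - (w 0)\<^sup>2) / 4 + 2 * (\<epsilon> * (c * (cos a - cos b)))"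
      by (simp add: radicand_def algebra_simps diff_divide_distrib)
    moreover have "0 \<le> \<epsilon> * M * D" using \<epsilon>_pos M_pos D0 by simp
    ultimately have "\<bar>radicand a v - radicand b w\<bar> \<le> \<epsilon> * M * D + 2 * (\<epsilon> * (C * D))"
      using 1 2 by linarith
    then show ?thesis by (simp add: algebra_simps)
  qed
  have b: "\<bar>initial_z s a v - initial_z s b w\<bar> \<le> \<epsilon> * ((M + 2 * C) / m) * D"
  proof -
    have "\<bar>initial_z s a v - initial_z s b w\<bar> = \<bar>sqrt (radicand a v) - sqrt (radicand b w)\<bar>"
      by (simp add: initial_z_def abs_minus_commute)
    also have "\<dots> \<le> \<bar>radicand a v - radicand b w\<bar> / m"
      by (rule sqrt_diff_le[OF m_pos radicand_ge radicand_ge])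
    also have "\<dots> \<le> \<epsilon> * (M + 2 * C) * D / m"
      using rad m_pos by (simp add: divide_right_mono)
    finally show ?thesis by simp
  qed
  have "\<bar>\<gamma> t * v t - \<gamma> t * w t\<bar> \<le> \<Gamma> * D" for t
    using \<gamma>_mult_le[OF D(2)] by (simp add: right_diff_distrib)
  then have "\<bar>mean_free_primitive (\<lambda>t. \<gamma> t * v t) t - mean_free_primitive (\<lambda>t. \<gamma> t * w t) t\<bar> \<le> 2 * (\<Gamma> * D)"
    using vp wp \<gamma> by (intro mean_free_primitive_diff_le periodic_continuous_mult)
  then have "\<epsilon>\<^sup>2 * \<bar>mean_free_primitive (\<lambda>t. \<gamma> t * v t) t - mean_free_primitive (\<lambda>t. \<gamma> t * w t) t\<bar>
      \<le> \<epsilon>\<^sup>2 * (2 * (\<Gamma> * D))"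
    by (rule mult_left_mono) simp
  also have "\<dots> \<le> \<epsilon> * (2 * (\<Gamma> * D))" using \<Gamma>_nonneg D0 by (intro \<epsilon>2_mult_le) auto
  finally have "\<bar>\<epsilon>\<^sup>2 * mean_free_primitive (\<lambda>t. \<gamma> t * v t) t - \<epsilon>\<^sup>2 * mean_free_primitive (\<lambda>t. \<gamma> t * w t) t\<bar>
      \<le> \<epsilon> * (2 * (\<Gamma> * D))"
    by (simp add: right_diff_distrib[symmetric] abs_mult)
  with b have "\<bar>path_z s a v t - path_z s b w t\<bar> \<le> \<epsilon> * ((M + 2 * C) / m) * D + \<epsilon> * (2 * (\<Gamma> * D))"
    unfolding path_z_def by linarith
  from \<gamma>_mult_le[OF this, of t] sin
  have "\<bar>forcing s a v t - forcing s b w t\<bar> \<le> C * (2 * \<epsilon> * (1 + 2 * M) * D)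
      + \<Gamma> * (\<epsilon> * ((M + 2 * C) / m) * D + \<epsilon> * (2 * (\<Gamma> * D)))"
    unfolding forcing_def by (simp add: algebra_simps)
  also have "\<dots> = \<epsilon> * (2 * C * (1 + 2 * M) + \<Gamma> * ((M + 2 * C) / m + 2 * \<Gamma>)) * D"
    by (simp add: algebra_simps)
  finally show ?thesis .
qed

text \<open>The components get separate bounds \<open>A\<close> and \<open>B\<close>; only their sum
  matters, since the product distance is at most the sum of the component distances.\<close>

lemma next_diff_le:
  assumes v: "admissible v" and w: "admissible w"
    and D: "\<bar>a - b\<bar> \<le> D" "\<And>t. \<bar>v t - w t\<bar> \<le> D"
  obtains A B where "\<bar>next_a s r a v - next_a s r b w\<bar> \<le> A"
    "\<And>t. \<bar>next_w s a v t - next_w s b w t\<bar> \<le> B" "A + B \<le> D / 2"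
proof
  define E where "E = \<epsilon> * (2 * C * (1 + 2 * M) + \<Gamma> * ((M + 2 * C) / m + 2 * \<Gamma>)) * D"
  let ?f = "forcing s a v" and ?g = "forcing s b w"
  let ?F = "mean_free_primitive ?f" and ?G = "mean_free_primitive ?g"
  have f: "periodic_continuous ?f" and g: "periodic_continuous ?g"
    using v w by (auto intro: periodic_continuous_forcing admissibleD)
  have fg: "\<bar>?f t - ?g t\<bar> \<le> E" for t unfolding E_def by (rule forcing_diff_le[OF assms])
  have FG: "\<bar>?F t - ?G t\<bar> \<le> 2 * E" for t by (rule mean_free_primitive_diff_le[OF f g fg])
  have "\<bar>mean ?F - mean ?G\<bar> \<le> 2 * E"
    using f g by (intro mean_diff_le[OF _ _ FG] periodic_continuousD periodic_continuous_mean_free_primitive)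
  then show "\<bar>next_w s a v t - next_w s b w t\<bar> \<le> 16 * E" for t
    using FG[of t] unfolding next_w_def abs_le_iff by argo
  have "\<bar>mean ?f - mean ?g\<bar> \<le> E"
    using f g by (intro mean_diff_le[OF _ _ fg] periodic_continuousD)
  moreover have E0: "0 \<le> E" using fg[of 0] by linarith
  ultimately have "\<bar>mean ?f - mean ?g\<bar> / c \<le> E / k"
    using k_pos k_le by (intro frac_le) auto
  moreover have "\<bar>- mean ?f / c - (- mean ?g / c)\<bar> = \<bar>mean ?f - mean ?g\<bar> / c"
    using c_pos by (simp flip: diff_divide_distrib add: abs_minus_commute)
  moreover have "sqrt (1 - q\<^sup>2) > 0"
    using q_pos q_less by (simp add: abs_square_less_1)
  \<comment> \<open>Both branches share the Lipschitz constant of \<open>arcsin\<close>, whose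
    arguments \<open>mean_forcing_div_le\<close> keeps within \<open>q\<close>.\<close>
  moreover have "\<bar>next_a s r a v - next_a s r b w\<bar>
      \<le> \<bar>- mean ?f / c - (- mean ?g / c)\<bar> / sqrt (1 - q\<^sup>2)"
    using arcsin_lipschitz[OF q_pos q_less mean_forcing_div_le[OF v, of s a] mean_forcing_div_le[OF w, of s b]]
    by (simp add: next_a_def branch_def abs_minus_commute)
  ultimately show "\<bar>next_a s r a v - next_a s r b w\<bar> \<le> E / k / sqrt (1 - q\<^sup>2)"
    by (smt (verit) divide_right_mono)
  have "E / k / sqrt (1 - q\<^sup>2) + 16 * E
     = (\<epsilon> * (2 * C * (1 + 2 * M) + \<Gamma> * ((M + 2 * C) / m + 2 * \<Gamma>)) * (1 / (k * sqrt (1 - q\<^sup>2)) + 16)) * D"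
    unfolding E_def by (simp add: algebra_simps add_divide_distrib)
  also have "\<dots> \<le> 1 / 2 * D"
    using D(1) by (intro mult_right_mono contraction) linarith
  finally show "E / k / sqrt (1 - q\<^sup>2) + 16 * E \<le> D / 2" by simp
qed

end

section \<open>Unique fixed points by Banach's theorem\<close>

lemma Bcontfun_apply_periodic_continuous:
  assumes "periodic_continuous f" "\<And>t. \<bar>f t\<bar> \<le> B"
  shows "apply_bcontfun (Bcontfun f) = f"
  using assms by (intro Bcontfun_inverse bcontfun_normI) (auto simp: periodic_continuous_def)

context small_epsilon
begin

definition fixed_pair :: "bool \<Rightarrow> bool \<Rightarrow> real \<Rightarrow> (real \<Rightarrow> real) \<Rightarrow> bool"
  where "fixed_pair s r a w \<longleftrightarrow> admissible w \<and> next_a s r a w = a \<and> next_w s a w = w"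

text \<open>The bounded continuous functions with the uniform distance provide completeness. On
  admissible functions \<open>Bcontfun\<close> and \<open>apply_bcontfun\<close> are mutually
  inverse, so the result transfers back to plain functions.\<close>

lemma fixed_pair_ex1:
  "\<exists>!p. fixed_pair s r (fst p) (snd p)"
proof -
  define S :: "(real \<times> (real \<Rightarrow>\<^sub>C real)) set"
    where "S = UNIV \<times> {w. admissible (apply_bcontfun w)}"
  define T where "T p = (next_a s r (fst p) (apply_bcontfun (snd p)),
      Bcontfun (next_w s (fst p) (apply_bcontfun (snd p))))" for p
  have app: "apply_bcontfun (Bcontfun w) = w" if "admissible w" for w
    using that by (intro Bcontfun_apply_periodic_continuous[where B = M]) (auto simp: admissible_def)
  have "\<exists>!p\<in>S. T p = p"
  proof (rule Banach_fix[where c = "1/2"])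
    \<comment> \<open>Evaluation at a point is continuous for the uniform distance, so periodicity
      and the bound \<open>M\<close> are closed conditions.\<close>
    have cont: "continuous_on UNIV (\<lambda>w. apply_bcontfun w t)" for t :: real
      unfolding continuous_on_iff by (metis dist_bounded le_less_trans)
    have "closed {w. admissible (apply_bcontfun w)}"
      unfolding admissible_def periodic_continuous_def periodic_fun_simple'_def
      by (simp, intro closed_Collect_conj closed_Collect_all closed_Collect_eq closed_Collect_le
          continuous_intros cont)
    then have "closed S" unfolding S_def by (intro closed_Times) auto
    then show "complete S" by (simp add: complete_eq_closed)
    have "admissible (\<lambda>t. 0)"
      using M_pos by (auto simp: admissible_def)
    with app[OF this] have "(0, Bcontfun (\<lambda>t. 0)) \<in> S" by (simp add: S_def)
    then show "S \<noteq> {}" by blast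
    show "T ` S \<subseteq> S"
      by (auto simp: S_def T_def app admissible_next_w)
    fix x y assume xy: "x \<in> S" "y \<in> S"
    obtain a v b w where eq: "x = (a, v)" "y = (b, w)" by (metis surj_pair)
    have adm: "admissible v" "admissible w" using xy by (auto simp: S_def eq)
    have "\<bar>a - b\<bar> \<le> dist x y"
      using dist_fst_le[of x y] by (simp add: eq dist_real_def)
    moreover have "\<bar>v t - w t\<bar> \<le> dist x y" for t
      using dist_bounded[of v t w] dist_snd_le[of x y] by (simp add: eq dist_real_def)
    ultimately obtain A B where AB: "\<bar>next_a s r a v - next_a s r b w\<bar> \<le> A"
      "\<And>t. \<bar>next_w s a v t - next_w s b w t\<bar> \<le> B" "A + B \<le> dist x y / 2"
      using next_diff_le[OF adm, where a=a and b=b and s=s and r=r and D="dist x y"] by metis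
    have "dist (T x) (T y) \<le> dist (fst (T x)) (fst (T y)) + dist (snd (T x)) (snd (T y))"
      unfolding dist_prod_def by (rule sqrt_sum_squares_le_sum) auto
    also have "\<dots> \<le> A + B"
      using AB by (intro add_mono dist_bound)
        (auto simp: T_def eq dist_real_def app admissible_next_w adm)
    finally show "dist (T x) (T y) \<le> 1 / 2 * dist x y" using AB(3) by simp
  qed auto
  then obtain p where p: "p \<in> S" "T p = p" and uniq: "\<And>q. q \<in> S \<Longrightarrow> T q = q \<Longrightarrow> q = p"
    by blast
  show ?thesis
  proof (rule ex1I)
    show "fixed_pair s r (fst (fst p, apply_bcontfun (snd p))) (snd (fst p, apply_bcontfun (snd p)))"
    proof -
      have adm: "admissible (apply_bcontfun (snd p))" using p by (auto simp: S_def)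
      have "next_a s r (fst p) (snd p) = fst p" "Bcontfun (next_w s (fst p) (snd p)) = snd p"
        using p(2) by (simp_all add: T_def prod_eq_iff)
      with app[OF admissible_next_w[OF adm, of s "fst p"]] adm show ?thesis
        by (simp add: fixed_pair_def)
    qed
  next
    fix q assume "fixed_pair s r (fst q) (snd q)"
    then have q: "admissible (snd q)" "next_a s r (fst q) (snd q) = fst q"
       "next_w s (fst q) (snd q) = snd q" by (auto simp: fixed_pair_def)
    have "(fst q, Bcontfun (snd q)) = p"
      by (rule uniq) (simp_all add: S_def T_def app q)
    with app[OF q(1)] show "q = (fst p, apply_bcontfun (snd p))"
      by (auto simp: prod_eq_iff)
  qed
qed

lemma fixed_pairD:
  assumes "fixed_pair s r a w"
  shows "admissible w" "a = branch r (- mean (forcing s a w) / c)"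
    "w t = 4 * (mean_free_primitive (forcing s a w) t - mean (mean_free_primitive (forcing s a w)))"
  using assms by (auto simp: fixed_pair_def next_a_def next_w_def fun_eq_iff)

section \<open>From fixed points to periodic solutions\<close>

lemma sin_branch: "\<bar>x\<bar> \<le> 1 \<Longrightarrow> sin (branch r x) = x"
  by (auto simp: branch_def sin_diff abs_le_iff)

lemma cos_branch:
  assumes "\<bar>x\<bar> < 1"
  shows "r \<Longrightarrow> 0 < cos (branch r x)" "\<not> r \<Longrightarrow> cos (branch r x) < 0"
proof -
  have "x\<^sup>2 < 1" using assms by (simp add: abs_square_less_1)
  then have "0 < cos (arcsin x)" using assms by (simp add: cos_arcsin)
  then show "r \<Longrightarrow> 0 < cos (branch r x)" "\<not> r \<Longrightarrow> cos (branch r x) < 0"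
    by (auto simp: branch_def cos_diff)
qed

text \<open>The constant \<open>c * sin a\<close> left out of the forcing is minus its mean, so the
  forcing minus its mean is the full right-hand side of the equation.\<close>

lemma fixed_pair_sin:
  assumes "fixed_pair s r a w"
  shows "c * sin a = - mean (forcing s a w)"
proof -
  have "sin a = - mean (forcing s a w) / c"
    using fixed_pairD(2)[OF assms] sin_branch[of "- mean (forcing s a w) / c" r]
      mean_forcing_div_le[OF fixed_pairD(1)[OF assms], of s a] q_less by simp
  then show ?thesis using c_pos by simp
qed

text \<open>The bound \<open>q < 1\<close> keeps the cosine from vanishing, so its sign recovers
  \<open>r\<close>.\<close>

lemma fixed_pair_cos:
  assumes "fixed_pair s r a w"
  shows "r \<Longrightarrow> 0 < cos a" "\<not> r \<Longrightarrow> cos a < 0"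
  using fixed_pairD(2)[OF assms] cos_branch[of "- mean (forcing s a w) / c" r]
      mean_forcing_div_le[OF fixed_pairD(1)[OF assms], of s a] q_less by simp_all

lemma fixed_pair_solution:
  assumes fp: "fixed_pair s r a w"
  shows "(path_\<psi> a w, path_z s a w) \<in> periodic_solutions \<gamma> c (- 2 * m\<^sup>2) \<epsilon>"
proof -
  note adm = fixed_pairD(1)[OF fp]
  have w: "periodic_continuous w" using adm by (rule admissibleD)
  have g: "periodic_continuous (forcing s a w)" by (rule periodic_continuous_forcing[OF w])
  let ?J = "mean_free_primitive (forcing s a w)"
  let ?\<psi> = "path_\<psi> a w" and ?z = "path_z s a w"
  note gc = periodic_continuousD(1)[OF g]
  have J: "periodic_continuous ?J" by (rule periodic_continuous_mean_free_primitive[OF g])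
  have weq: "w = (\<lambda>t. 4 * (?J t - mean ?J))" using fixed_pairD(3)[OF fp] by blast
  \<comment> \<open>With mean zero, the mean-free primitive of \<open>w\<close> is a genuine
    primitive, and \<open>path_\<psi>\<close> has derivative
    \<open>\<epsilon> * w t\<close>.\<close>
  have "mean w = 4 * mean (\<lambda>t. ?J t - mean ?J)" by (subst weq) (simp only: integral_mult_right)
  also have "mean (\<lambda>t. ?J t - mean ?J) = 0"
    by (simp add: integral_diff continuous_on_UNIV_integrable periodic_continuousD(1)[OF J])
  finally have mw: "mean w = 0" by simp
  have acc: "forcing s a w t - mean (forcing s a w) = c * sin (?\<psi> t) + \<gamma> t * ?z t" for t
    using fixed_pair_sin[OF fp] by (simp add: forcing_def algebra_simps)
  have \<psi>': "(?\<psi> has_real_derivative \<epsilon> * w t) (at t)" for t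
    unfolding path_\<psi>_def using mean_free_primitive(2)[OF periodic_continuousD(1)[OF w], of t] mw
    by (auto intro!: derivative_eq_intros)
  have w': "(w has_real_derivative 4 * (c * sin (?\<psi> t) + \<gamma> t * ?z t)) (at t)" for t
  proof -
    have "((\<lambda>t. 4 * (?J t - mean ?J)) has_real_derivative 4 * (forcing s a w t - mean (forcing s a w))) (at t)"
      by (auto intro!: derivative_eq_intros mean_free_primitive(2)[OF gc])
    then show ?thesis unfolding acc weq[symmetric] .
  qed
  define \<mu> where "\<mu> = mean (\<lambda>t. \<gamma> t * w t)"
  have z': "(?z has_real_derivative \<epsilon>\<^sup>2 * (\<gamma> t * w t - \<mu>)) (at t)" for t
    unfolding path_z_def \<mu>_def
    by (auto intro!: derivative_eq_intros mean_free_primitive(2) continuous_intros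
        periodic_continuousD(1)[OF w] periodic_continuousD(1)[OF \<gamma>])
  define I where "I t = (\<epsilon> * w t)\<^sup>2 / 2 - 4 * \<epsilon> * c * (1 - cos (?\<psi> t)) - 2 * (?z t)\<^sup>2" for t
  \<comment> \<open>Along the path all terms cancel as for a true solution, except the one coming
    from the subtracted \<open>\<mu>\<close>.\<close>
  have I': "(I has_real_derivative 4 * \<epsilon>\<^sup>2 * \<mu> * ?z t) (at t)" for t
    unfolding I_def
    by (rule derivative_eq_intros \<psi>' w' z' refl | simp)+ (simp add: algebra_simps power2_eq_square)
  have per\<psi>: "?\<psi> (t + 1) = ?\<psi> t" and perz: "?z (t + 1) = ?z t" and perw: "w (t + 1) = w t" for t
    by (rule periodic_continuousD(2) periodic_continuous_path_\<psi> periodic_continuous_path_z w)+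
  \<comment> \<open>The mean value theorem over one period gives a time where \<open>\<mu>\<close>
    times \<open>z\<close> vanishes, and \<open>z\<close> has no zero.\<close>
  have "I (0 + 1) = I 0" unfolding I_def per\<psi> perz perw ..
  then have "\<exists>t>0. t < 1 \<and> I 1 - I 0 = (1 - 0) * (4 * \<epsilon>\<^sup>2 * \<mu> * ?z t)"
    by (intro MVT2) (auto intro: I')
  then obtain t where "4 * \<epsilon>\<^sup>2 * \<mu> * ?z t = 0" using \<open>I (0 + 1) = I 0\<close> by auto
  moreover have "?z t \<noteq> 0" using path_z_sign[OF adm, of s a t] by (cases s) auto
  ultimately have \<mu>: "\<mu> = 0" using \<epsilon>_pos by simp
  have "I t = I 0" for t
    using I' \<mu> by (intro DERIV_isconst_all) auto
  \<comment> \<open>The radicand is the level set equation at time 0, solved for the square of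
    \<open>z\<close>.\<close>
  moreover have "I 0 = - 2 * m\<^sup>2"
  proof -
    have "?\<psi> 0 = a" "?z 0 = initial_z s a w"
      using w \<gamma> by (auto simp: path_\<psi>_def path_z_def mean_free_primitive(1) periodic_continuousD
          intro!: mean_free_primitive(1) continuous_intros)
    then show ?thesis
      by (simp add: I_def initial_z_square radicand_def power_mult_distrib algebra_simps)
  qed
  moreover have d\<psi>: "deriv ?\<psi> = (\<lambda>t. \<epsilon> * w t)" using \<psi>' DERIV_imp_deriv by blast
  moreover have "((\<lambda>t. \<epsilon> * w t) has_real_derivative 4 * (\<epsilon> * c * sin (?\<psi> t) + \<epsilon> * \<gamma> t * ?z t)) (at t)" for t
    by (rule derivative_eq_intros w' refl)+ (simp add: algebra_simps)
  moreover have "(?z has_real_derivative \<epsilon> * \<gamma> t * (\<epsilon> * w t)) (at t)" for t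
    using z'[of t] \<mu> by (simp add: power2_eq_square mult_ac)
  ultimately show ?thesis
    using \<psi>' per\<psi> perz
    by (simp add: periodic_solutions_def is_solution_def first_integral_def periodic_fun_simple'_def
        I_def)
qed

section \<open>From periodic solutions to fixed points\<close>

text \<open>A maximum of \<open>\<bar>\<psi>'\<bar>\<close> is compared with a zero of \<open>\<psi>'\<close>; the first integral bounds \<open>z\<close> by \<open>\<psi>'\<close>.\<close>

lemma solution_speed_le:
  assumes "(\<psi>, z) \<in> periodic_solutions \<gamma> c (- 2 * m\<^sup>2) \<epsilon>"
  shows "\<bar>deriv \<psi> t\<bar> \<le> \<epsilon> * M"
proof -
  have \<psi>': "\<And>t. (\<psi> has_real_derivative deriv \<psi> t) (at t)"
    and \<psi>'': "\<And>t. (deriv \<psi> has_real_derivative 4 * (\<epsilon> * c * sin (\<psi> t) + \<epsilon> * \<gamma> t * z t)) (at t)"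
    and I: "\<And>t. (deriv \<psi> t)\<^sup>2 / 2 - 4 * \<epsilon> * c * (1 - cos (\<psi> t)) - 2 * (z t)\<^sup>2 = - 2 * m\<^sup>2"
    and per: "periodic_fun_simple' \<psi>"
    using assms by (auto simp: periodic_solutions_def is_solution_def first_integral_def)
  have pc: "periodic_continuous (deriv \<psi>)" by (rule periodic_continuous_deriv[OF per \<psi>' \<psi>''])
  obtain t0 where t0: "t0 \<in> {0..1}" "deriv \<psi> t0 = 0"
  proof -
    have "\<psi> 1 = \<psi> 0" using per unfolding periodic_fun_simple'_def by (metis add_0)
    then have "\<exists>t>0. t < 1 \<and> \<psi> 1 - \<psi> 0 = (1 - 0) * deriv \<psi> t"
      by (intro MVT2) (auto intro: \<psi>')
    then obtain t where "0 < t" "t < 1" "deriv \<psi> t = 0" using \<open>\<psi> 1 = \<psi> 0\<close> by auto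
    then show ?thesis using that[of t] by simp
  qed
  obtain t1 where t1: "t1 \<in> {0..1}" and V: "\<And>t. \<bar>deriv \<psi> t\<bar> \<le> \<bar>deriv \<psi> t1\<bar>"
    using periodic_continuous_attains_max[OF pc] by blast
  let ?V = "\<bar>deriv \<psi> t1\<bar>"
  \<comment> \<open>In the first integral the cosine term only lowers the square of
    \<open>z\<close>, and the rest is at most the square of the bound.\<close>
  have zle: "\<bar>z t\<bar> \<le> ?V / 2 + m" for t
  proof (rule power2_le_imp_le)
    have "0 \<le> \<epsilon> * c * (1 - cos (\<psi> t))" using \<epsilon>_pos c_pos by simp
    then have "(z t)\<^sup>2 \<le> (deriv \<psi> t)\<^sup>2 / 4 + m\<^sup>2" using I[of t] by linarith
    also have "\<dots> \<le> ?V\<^sup>2 / 4 + m\<^sup>2" using V[of t] by (simp add: abs_le_square_iff)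
    also have "\<dots> \<le> (?V / 2 + m)\<^sup>2" using m_pos by (simp add: power2_sum power_divide)
    finally show "\<bar>z t\<bar>\<^sup>2 \<le> (?V / 2 + m)\<^sup>2" by simp
  qed (use m_pos in simp)
  have "norm (deriv \<psi> t1 - deriv \<psi> t0) \<le> 4 * \<epsilon> * (C + \<Gamma> * (?V / 2 + m)) * norm (t1 - t0)"
  proof (rule field_differentiable_bound[where S = UNIV and f = "deriv \<psi>"
      and f' = "\<lambda>t. 4 * (\<epsilon> * c * sin (\<psi> t) + \<epsilon> * \<gamma> t * z t)"])
    fix t :: real
    have "\<bar>c * sin (\<psi> t) + \<gamma> t * z t\<bar> \<le> C + \<Gamma> * (?V / 2 + m)"
      using c_mult_le[of "sin (\<psi> t)" 1] \<gamma>_mult_le[OF zle, of t t]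
      by (intro order_trans[OF abs_triangle_ineq] add_mono) auto
    then have "4 * \<epsilon> * \<bar>c * sin (\<psi> t) + \<gamma> t * z t\<bar> \<le> 4 * \<epsilon> * (C + \<Gamma> * (?V / 2 + m))"
      using \<epsilon>_pos by (intro mult_left_mono) auto
    moreover have "4 * (\<epsilon> * c * sin (\<psi> t) + \<epsilon> * \<gamma> t * z t) = 4 * \<epsilon> * (c * sin (\<psi> t) + \<gamma> t * z t)"
      by (simp add: algebra_simps)
    ultimately show "norm (4 * (\<epsilon> * c * sin (\<psi> t) + \<epsilon> * \<gamma> t * z t)) \<le> 4 * \<epsilon> * (C + \<Gamma> * (?V / 2 + m))"
      using \<epsilon>_pos by (simp add: abs_mult)
  qed (use \<psi>'' in simp_all)
  also have "\<dots> \<le> 4 * \<epsilon> * (C + \<Gamma> * (?V / 2 + m)) * 1"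
    using t0 t1 \<epsilon>_pos C_pos \<Gamma>_nonneg m_pos by (intro mult_left_mono) auto
  finally have "?V \<le> 4 * \<epsilon> * C + 4 * \<epsilon> * \<Gamma> * m + (4 * \<epsilon> * \<Gamma>) * (?V / 2)"
    using t0 by (simp add: algebra_simps)
  \<comment> \<open>Half of the maximal speed is absorbed into the left-hand side.\<close>
  moreover have "(4 * \<epsilon> * \<Gamma>) * (?V / 2) \<le> 1 * (?V / 2)"
    using \<epsilon>\<Gamma> by (intro mult_right_mono) auto
  ultimately have "?V \<le> 8 * \<epsilon> * C + 8 * \<epsilon> * \<Gamma> * m" by linarith
  also have "\<dots> = \<epsilon> * (8 * C + 8 * (\<Gamma> * m))" by (simp add: algebra_simps)
  also have "\<dots> \<le> \<epsilon> * M"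
  proof (rule mult_left_mono)
    have "0 \<le> \<Gamma> * m" using \<Gamma>_nonneg m_pos by simp
    then show "8 * C + 8 * (\<Gamma> * m) \<le> M"
      unfolding M_eq distrib_left using C_pos \<Gamma>_nonneg by linarith
  qed (use \<epsilon>_pos in simp)
  finally show ?thesis using V[of t] by linarith
qed

lemma branch_surj:
  assumes "sin a = x" "\<bar>x\<bar> \<le> 1"
  obtains r and n :: int where "a = branch r x + 2 * pi * of_int n"
proof -
  have "sin a = sin (arcsin x)" using assms by (simp add: abs_le_iff)
  then obtain y where "y \<in> \<int>" "a = arcsin x + 2 * y * pi \<or> a = - arcsin x + (2 * y + 1) * pi"
    unfolding sin_eq by blast
  then obtain n :: int where "a = branch True x + 2 * pi * of_int n \<or> a = branch False x + 2 * pi * of_int n"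
    by (auto simp: branch_def algebra_simps elim!: Ints_cases)
  then show thesis using that by blast
qed

text \<open>Integrating each equation over a period shows that the derivatives of
  \<open>\<psi>\<close>, \<open>z\<close> and \<open>w\<close> have mean zero, so the mean-free
  primitives reproduce the solution itself.\<close>

lemma solution_fixed_pair:
  assumes sol: "(\<psi>, z) \<in> periodic_solutions \<gamma> c (- 2 * m\<^sup>2) \<epsilon>"
  obtains s r a w and n :: int where "fixed_pair s r a w"
    "\<And>t. \<psi> t = path_\<psi> a w t + 2 * pi * of_int n" "z = path_z s a w"
proof -
  have \<psi>': "\<And>t. (\<psi> has_real_derivative deriv \<psi> t) (at t)"
    and \<psi>'': "\<And>t. (deriv \<psi> has_real_derivative 4 * (\<epsilon> * c * sin (\<psi> t) + \<epsilon> * \<gamma> t * z t)) (at t)"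
    and z': "\<And>t. (z has_real_derivative \<epsilon> * \<gamma> t * deriv \<psi> t) (at t)"
    and I: "\<And>t. (deriv \<psi> t)\<^sup>2 / 2 - 4 * \<epsilon> * c * (1 - cos (\<psi> t)) - 2 * (z t)\<^sup>2 = - 2 * m\<^sup>2"
    and per: "periodic_fun_simple' \<psi>" and perz: "periodic_fun_simple' z"
    using sol by (auto simp: periodic_solutions_def is_solution_def first_integral_def)
  have ends: "\<psi> 1 = \<psi> 0" "z 1 = z 0"
    using per perz unfolding periodic_fun_simple'_def by (metis add_0)+
  define w where "w t = deriv \<psi> t / \<epsilon>" for t
  have \<psi>w: "deriv \<psi> t = \<epsilon> * w t" for t using \<epsilon>_pos by (simp add: w_def)
  have w': "(w has_real_derivative 4 * (c * sin (\<psi> t) + \<gamma> t * z t)) (at t)" for t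
  proof -
    have "(w has_real_derivative 4 * (\<epsilon> * c * sin (\<psi> t) + \<epsilon> * \<gamma> t * z t) / \<epsilon>) (at t)"
      unfolding w_def by (rule DERIV_cdivide[OF \<psi>''])
    moreover have "4 * (\<epsilon> * c * sin (\<psi> t) + \<epsilon> * \<gamma> t * z t) / \<epsilon> = 4 * (c * sin (\<psi> t) + \<gamma> t * z t)"
      using \<epsilon>_pos by (simp add: field_simps)
    ultimately show ?thesis by simp
  qed
  have wp: "periodic_continuous w"
    using periodic_continuous_mult[OF periodic_continuous_deriv[OF per \<psi>' \<psi>''] periodic_continuous_const[of "1 / \<epsilon>"]]
    by (simp add: w_def[abs_def])
  note wc = periodic_continuousD(1)[OF wp]
  have "\<bar>w t\<bar> \<le> M" for t
    using solution_speed_le[OF sol, of t] \<epsilon>_pos by (simp add: w_def pos_divide_le_eq mult.commute)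
  then have adm: "admissible w" using wp by (simp add: admissible_def)
  have "mean (deriv \<psi>) = 0" using mean_deriv[OF \<psi>'] ends by simp
  then have mw: "mean w = 0" by (simp add: w_def[abs_def])
  have "\<psi> t = path_\<psi> (\<psi> 0) w t" for t
  proof -
    have "mean_free_primitive w = (\<lambda>t. \<psi> t / \<epsilon> - \<psi> 0 / \<epsilon>)"
      by (rule mean_free_primitive_eqI[OF wc])
         (use DERIV_cdivide[OF \<psi>', where c = \<epsilon>] in \<open>simp add: mw w_def\<close>)
    then show ?thesis using \<epsilon>_pos by (simp add: path_\<psi>_def right_diff_distrib)
  qed
  \<comment> \<open>With this sign \<open>initial_z\<close> is \<open>\<bar>z 0\<bar>\<close> with
    the sign of \<open>z 0\<close>, hence \<open>z 0\<close>.\<close>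
  define s where "s \<longleftrightarrow> 0 \<le> z 0"
  have z0_square: "(z 0)\<^sup>2 = radicand (\<psi> 0) w"
    using I[of 0] by (simp add: radicand_def \<psi>w power_mult_distrib)
  have z0: "z 0 = initial_z s (\<psi> 0) w"
    by (simp add: initial_z_def s_def flip: z0_square)
  have z: "z = path_z s (\<psi> 0) w"
  proof
    fix t
    have d: "((\<lambda>t. z t / \<epsilon>\<^sup>2) has_real_derivative \<gamma> t * w t) (at t)" for t
      using DERIV_cdivide[OF z', where c = "\<epsilon>\<^sup>2"] \<epsilon>_pos by (simp add: \<psi>w power2_eq_square)
    \<comment> \<open>Periodicity of \<open>z\<close> makes the mean subtracted in
      \<open>path_z\<close> vanish.\<close>
    have m0: "mean (\<lambda>t. \<gamma> t * w t) = 0" using mean_deriv[OF d] ends by simp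
    have "mean_free_primitive (\<lambda>t. \<gamma> t * w t) = (\<lambda>t. z t / \<epsilon>\<^sup>2 - z 0 / \<epsilon>\<^sup>2)"
      by (rule mean_free_primitive_eqI)
         (use d in \<open>auto simp: m0 intro!: continuous_intros wc periodic_continuousD(1)[OF \<gamma>]\<close>)
    then show "z t = path_z s (\<psi> 0) w t"
      using \<epsilon>_pos by (simp add: path_z_def right_diff_distrib z0)
  qed
  have acc: "c * sin (\<psi> t) + \<gamma> t * z t = forcing s (\<psi> 0) w t + c * sin (\<psi> 0)" for t
    using \<open>\<And>t. \<psi> t = path_\<psi> (\<psi> 0) w t\<close>[of t] z by (simp add: forcing_def algebra_simps)
  let ?g = "forcing s (\<psi> 0) w"
  note gp = periodic_continuous_forcing[OF wp, of s "\<psi> 0"]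
  note gc = periodic_continuousD(1)[OF gp]
  \<comment> \<open>Periodicity of \<open>w\<close> gives the solvability condition that determines
    \<open>sin (\<psi> 0)\<close>.\<close>
  have "mean (\<lambda>t. 4 * (?g t + c * sin (\<psi> 0))) = w (0 + 1) - w 0"
    using mean_deriv[OF w'] by (simp add: acc)
  also have "\<dots> = 0" unfolding periodic_continuousD(2)[OF wp] by simp
  also have "mean (\<lambda>t. 4 * (?g t + c * sin (\<psi> 0))) = 4 * (mean ?g + c * sin (\<psi> 0))"
    by (simp only: integral_mult_right) (simp add: mean_add gc)
  finally have mg: "c * sin (\<psi> 0) = - mean ?g" by simp
  have Jg: "mean_free_primitive ?g = (\<lambda>t. w t / 4 - w 0 / 4)"
    by (rule mean_free_primitive_eqI[OF gc])
       (use DERIV_cdivide[OF w', where c = 4] in \<open>simp add: acc mg diff_divide_distrib\<close>)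
  \<comment> \<open>Since \<open>w\<close> has mean zero, subtracting this mean from the primitive
    cancels \<open>w 0\<close> and leaves \<open>w t / 4\<close>.\<close>
  have "mean (mean_free_primitive ?g) = - w 0 / 4"
    unfolding Jg using mw by (simp add: integral_diff continuous_on_UNIV_integrable wc continuous_intros)
  then have w_fix: "next_w s (\<psi> 0) w = w"
    by (simp add: fun_eq_iff next_w_def) (simp add: Jg)
  have "sin (\<psi> 0) = - mean ?g / c" using mg c_pos by (simp add: field_simps)
  moreover have "\<bar>- mean ?g / c\<bar> \<le> 1"
    using mean_forcing_div_le[OF adm, of s "\<psi> 0"] q_less by linarith
  ultimately obtain r and n :: int where n: "\<psi> 0 = branch r (- mean ?g / c) + 2 * pi * of_int n"
    by (rule branch_surj)
  \<comment> \<open>This representative of \<open>\<psi> 0\<close> is the exact value of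
    \<open>branch\<close>. The shift changes neither sine nor cosine, so \<open>path_z\<close> and
    the forcing stay the same.\<close>
  define a where "a = \<psi> 0 - 2 * pi * of_int n"
  have \<psi>0: "\<psi> 0 = a + 2 * pi * of_int n" by (simp add: a_def)
  have trig: "sin (x + 2 * pi * of_int n) = sin x" "cos (x + 2 * pi * of_int n) = cos x" for x :: real
    using sin_cos_eq_iff[of "x + 2 * pi * of_int n" x] by blast+
  have path: "path_\<psi> (\<psi> 0) w t = path_\<psi> a w t + 2 * pi * of_int n" for t
    by (simp add: path_\<psi>_def \<psi>0)
  have "initial_z s (\<psi> 0) w = initial_z s a w"
    unfolding initial_z_def radicand_def \<psi>0 trig ..
  then have path_z: "path_z s (\<psi> 0) w = path_z s a w" by (simp add: path_z_def fun_eq_iff)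
  have forc: "forcing s (\<psi> 0) w = forcing s a w"
    unfolding forcing_def path path_z by (simp add: trig \<psi>0)
  have "fixed_pair s r a w"
    using adm n w_fix by (simp add: fixed_pair_def next_a_def next_w_def[abs_def] forc a_def)
  moreover have "\<psi> t = path_\<psi> a w t + 2 * pi * of_int n" for t
    using \<open>\<And>t. \<psi> t = path_\<psi> (\<psi> 0) w t\<close>[of t] path by simp
  ultimately show thesis using that z path_z by blast
qed

section \<open>Counting the solutions\<close>

text \<open>The classes correspond bijectively to the pairs \<open>(s, r)\<close>, each represented
  by the solution built from its unique fixed pair.\<close>

lemma card_periodic_solutions:
  "card (periodic_solutions \<gamma> c (- 2 * m\<^sup>2) \<epsilon> // shift_2pi) = 4"
proof -
  let ?P = "periodic_solutions \<gamma> c (- 2 * m\<^sup>2) \<epsilon>"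
  define fp where "fp = (\<lambda>(s, r). THE p. fixed_pair s r (fst p) (snd p))"
  have fp: "fixed_pair s r (fst (fp (s, r))) (snd (fp (s, r)))" for s r
    using theI'[OF fixed_pair_ex1[of s r]] by (simp add: fp_def)
  have fp_eq: "fp (s, r) = (a, w)" if "fixed_pair s r a w" for s r a w
    using the1_equality[OF fixed_pair_ex1[of s r], of "(a, w)"] that by (simp add: fp_def)
  define sol where "sol p = (path_\<psi> (fst (fp p)) (snd (fp p)), path_z (fst p) (fst (fp p)) (snd (fp p)))" for p
  define cls where "cls p = shift_2pi `` {sol p}" for p
  have sol: "sol p \<in> ?P" for p
    using fixed_pair_solution[OF fp[of "fst p" "snd p"]] by (simp add: sol_def)
  have "?P // shift_2pi = range cls"
  proof (intro equalityI subsetI)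
    fix X assume "X \<in> ?P // shift_2pi"
    then obtain \<psi> z where P: "(\<psi>, z) \<in> ?P" and X: "X = shift_2pi `` {(\<psi>, z)}"
      by (auto elim!: quotientE)
    obtain s r a w n where *: "fixed_pair s r a w"
      "\<And>t. \<psi> t = path_\<psi> a w t + 2 * pi * of_int n" "z = path_z s a w"
      using solution_fixed_pair[OF P] by metis
    have "(sol (s, r), (\<psi>, z)) \<in> shift_2pi"
      using *(2,3) by (auto simp: sol_def fp_eq[OF *(1)] shift_2pi_def)
    then have "cls (s, r) = X"
      unfolding cls_def X by (rule equiv_class_eq[OF equiv_shift_2pi])
    then show "X \<in> range cls" by blast
  qed (use sol in \<open>auto simp: cls_def intro!: quotientI\<close>)
  moreover have "inj cls"
  proof (rule injI)
    fix p p' assume "cls p = cls p'"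
    then have "(sol p, sol p') \<in> shift_2pi"
      unfolding cls_def by (rule eq_equiv_class[OF _ equiv_shift_2pi]) simp
    moreover obtain s r s' r' where p: "p = (s, r)" "p' = (s', r')" by fastforce
    moreover obtain a w a' w' where fpp: "fp (s, r) = (a, w)" "fp (s', r') = (a', w')" by fastforce
    ultimately obtain n :: int where n: "\<And>t. path_\<psi> a' w' t = path_\<psi> a w t + 2 * pi * of_int n"
      and z: "path_z s' a' w' = path_z s a w"
      by (auto simp: shift_2pi_def sol_def)
    have f: "fixed_pair s r a w" and f': "fixed_pair s' r' a' w'"
      using fp[of s r] fp[of s' r'] fpp by simp_all
    note ad = fixed_pairD(1)[OF f] and ad' = fixed_pairD(1)[OF f']
    \<comment> \<open>Equivalent solutions have the same \<open>z\<close>, whose sign determines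
      \<open>s\<close>.\<close>
    have "s = s'"
      using path_z_sign[OF ad, of s a 0] path_z_sign[OF ad', of s' a' 0] z by fastforce
    moreover have "a' = a + 2 * pi * of_int n"
      using n[of 0] mean_free_primitive(1)[OF periodic_continuousD(1)[OF admissibleD(1)[OF ad]]]
        mean_free_primitive(1)[OF periodic_continuousD(1)[OF admissibleD(1)[OF ad']]]
      by (simp add: path_\<psi>_def)
    \<comment> \<open>The initial angles differ by a multiple of \<open>2 * pi\<close>, and the sign
      of their common cosine determines \<open>r\<close>.\<close>
    then have "cos a' = cos a" using sin_cos_eq_iff[of a' a] by blast
    then have "r = r'" using fixed_pair_cos[OF f] fixed_pair_cos[OF f'] by fastforce
    ultimately show "p = p'" by (simp add: p)
  qed
  ultimately have "card (?P // shift_2pi) = card (UNIV :: (bool \<times> bool) set)"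
    by (simp only: card_image)
  then show ?thesis by (simp add: card_UNIV_bool UNIV_Times_UNIV[symmetric] del: UNIV_Times_UNIV)
qed

end

section \<open>Meeting the smallness conditions\<close>

lemma eventually_mult_le_at_right_0:
  fixes K B :: real
  assumes "0 < B"
  shows "\<forall>\<^sub>F \<epsilon> in at_right 0. \<epsilon> * K \<le> B"
proof -
  have "((\<lambda>\<epsilon>. \<epsilon> * K) \<longlongrightarrow> 0 * K) (at_right 0)"
    by (intro tendsto_intros)
  then have "\<forall>\<^sub>F \<epsilon> in at_right 0. \<epsilon> * K < B"
    by (rule order_tendstoD(2)) (use assms in simp)
  then show ?thesis by eventually_elim simp
qed

lemma C2_differentiable_on_imp_isCont: "f C2_differentiable_on S \<Longrightarrow> x \<in> S \<Longrightarrow> isCont f x"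
  unfolding C2_differentiable_on_def using DERIV_isCont by blast

theorem theorem12:
  fixes \<gamma> c :: "real \<Rightarrow> real" and d :: real and U :: "real set"
  assumes "periodic_fun_simple' \<gamma>"
    and "\<gamma> C2_differentiable_on UNIV"
    and "d < 0"
    and "open U" and "0 \<in> U"
    and "\<And>x. x \<in> U \<Longrightarrow> c x > 0"
    and "c C2_differentiable_on U"
    and "c 0 > 0"
    and "sqrt (- d / 2) * \<bar>integral {0..1} \<gamma>\<bar> < c 0"
  shows "\<forall>\<^sub>F \<epsilon> in at_right 0. card (periodic_solutions \<gamma> (c \<epsilon>) d \<epsilon> // shift_2pi) = 4"
proof -
  define m where "m = sqrt (- d / 2)"
  have m: "0 < m" and d: "d = - 2 * m\<^sup>2"
    using assms(3) by (auto simp: m_def)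
  have "\<gamma> C2_differentiable_on UNIV \<Longrightarrow> continuous_on UNIV \<gamma>"
    using C2_differentiable_on_imp_isCont continuous_at_imp_continuous_on by blast
  then have \<gamma>: "periodic_continuous \<gamma>" using assms(1,2) by (simp add: periodic_continuous_def)
  obtain \<Gamma> where \<Gamma>: "\<And>t. \<bar>\<gamma> t\<bar> \<le> \<Gamma>"
  proof -
    show thesis by (rule periodic_continuous_attains_max[OF \<gamma>]) (rule that)
  qed
  \<comment> \<open>The midpoint between 1 and the limiting size of the argument of
    \<open>arcsin\<close>, which the strict hypothesis keeps below 1.\<close>
  define q where "q = (1 + m * \<bar>mean \<gamma>\<bar> / c 0) / 2"
  have less: "m * \<bar>mean \<gamma>\<bar> / c 0 < 1" "0 \<le> m * \<bar>mean \<gamma>\<bar> / c 0"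
    using assms(8,9) m by (auto simp: m_def)
  then have q: "0 < q" "q < 1" by (auto simp: q_def)
  have "m * \<bar>mean \<gamma>\<bar> / c 0 < q" using field_less_half_sum[OF less(1)] by (simp add: q_def add.commute)
  then have mq: "m * \<bar>mean \<gamma>\<bar> < q * c 0" using assms(8) by (simp add: pos_divide_less_eq)
  \<comment> \<open>The midpoint leaves room on both sides: \<open>q * c \<epsilon>\<close> stays
    above \<open>p\<close> by continuity, and the \<open>O(\<epsilon>)\<close> errors in
    \<open>nondegenerate\<close> fit below it.\<close>
  define p where "p = (m * \<bar>mean \<gamma>\<bar> + q * c 0) / 2"
  \<comment> \<open>Both \<open>C\<close> and \<open>k\<close> enclose \<open>c \<epsilon>\<close>
    near 0 independently of \<open>\<epsilon>\<close>, so that \<open>M\<close> and the Lipschitz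
    constants are uniform.\<close>
  define C where "C = 2 * c 0"
  define k where "k = c 0 / 2"
  define M where "M = 16 * (2 * C + \<Gamma> * (m + 1))"
  have "isCont c 0" using assms(5,7) by (rule C2_differentiable_on_imp_isCont[rotated])
  then have lim: "(c \<longlongrightarrow> c 0) (at_right 0)"
    by (simp add: continuous_at filterlim_at_split)
  have "\<forall>\<^sub>F \<epsilon> in at_right 0. c \<epsilon> < C" "\<forall>\<^sub>F \<epsilon> in at_right 0. k < c \<epsilon>"
    using assms(8) by (intro order_tendstoD[OF lim]; simp add: C_def k_def)+
  moreover have "((\<lambda>\<epsilon>. q * c \<epsilon>) \<longlongrightarrow> q * c 0) (at_right 0)" by (intro tendsto_intros lim)
  then have "\<forall>\<^sub>F \<epsilon> in at_right 0. p < q * c \<epsilon>"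
    by (rule order_tendstoD) (use mq in \<open>simp add: p_def\<close>)
  moreover have "\<forall>\<^sub>F \<epsilon> in at_right 0. \<epsilon> * (M * (2 * C + \<Gamma> + 2 * \<Gamma>\<^sup>2)) \<le> p - m * \<bar>mean \<gamma>\<bar>"
    by (rule eventually_mult_le_at_right_0) (use mq in \<open>simp add: p_def field_simps\<close>)
  moreover have "\<forall>\<^sub>F \<epsilon> in at_right 0. \<epsilon> * ((2 * C * (1 + 2 * M) + \<Gamma> * ((M + 2 * C) / m + 2 * \<Gamma>))
      * (1 / (k * sqrt (1 - q\<^sup>2)) + 16)) \<le> 1 / 2"
    "\<forall>\<^sub>F \<epsilon> in at_right 0. \<epsilon> * M \<le> 1" "\<forall>\<^sub>F \<epsilon> in at_right 0. \<epsilon> * (8 * \<Gamma>) \<le> m"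
    "\<forall>\<^sub>F \<epsilon> in at_right 0. \<epsilon> * (4 * \<Gamma>) \<le> 1" "\<forall>\<^sub>F \<epsilon> in at_right 0. \<epsilon> * (16 * C) \<le> 3 * m\<^sup>2"
    "\<forall>\<^sub>F \<epsilon> in at_right 0. \<epsilon> * 1 \<le> (1::real)"
    by (rule eventually_mult_le_at_right_0; use m in simp)+
  moreover have "\<forall>\<^sub>F \<epsilon> in at_right 0. (0::real) < \<epsilon>" by (rule eventually_at_right_less)
  ultimately show ?thesis
  proof eventually_elim
    case (elim \<epsilon>)
    have "small_epsilon \<gamma> (c \<epsilon>) \<epsilon> m \<Gamma> C k q M"
    proof
      show "m * \<bar>mean \<gamma>\<bar> + \<epsilon> * M * (2 * C + \<Gamma> + 2 * \<Gamma>\<^sup>2) \<le> q * c \<epsilon>"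
        unfolding mult.assoc using elim(3,4) by linarith
      show "0 < k" using assms(8) by (simp add: k_def)
    qed (use elim q m \<gamma> \<Gamma> in \<open>simp_all add: M_def mult_ac\<close>)
    then show ?case unfolding d by (rule small_epsilon.card_periodic_solutions)
  qed
qed

end
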